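(* Let $\succ$ be a binary relation (a not necessarily strict preference relation) on the real linear space $Y$ with pre-domination structure $\tilde D_\succ$, and let $F,D\subseteq Y$. (a) If $\tilde D_\succ(y)=D$ for all $y\in F$, then $\operatorname{Min}(F,\succ)=\operatorname{Eff}(F,D\setminus(-D))$. If, in this situation, $\succ$ is asymmetric or antisymmetric, then $\operatorname{Min}(F,\succ)=\operatorname{Eff}(F,D)$. (b) If $\tilde D_\succ(y)\subseteq D$ for all $y\in F$, then $\operatorname{Eff}(F,D)\subseteq\operatorname{Min}(F,\succ)$. (c) If $\succ$ is asymmetric or antisymmetric and $D\subseteq\tilde D_\succ(y)$ for all $y\in F$, then $\operatorname{Min}(F,\succ)\subseteq\operatorname{Eff}(F,D)$.
   Context: The pre-domination structure of $\succ$ is $\tilde D_\succ:Y\to\mathcal P(Y)$, $\tilde D_\succ(y):=\{\tilde d\in Y\mid y-\tilde d\succ y\}$. $\operatorname{Min}(F,\succ):=\{y^0\in F\mid\forall y\in F:(y\succ y^0\Rightarrow y^0\succ y)\}$. $\operatorname{Eff}(F,D):=\{y^0\in F\mid F\cap(y^0-D)\subseteq\{y^0\}\}$. Asymmetric: $y^1\succ y^2$ implies not $y^2\succ y^1$. Antisymmetric: $y^1\succ y^2$ and $y^2\succ y^1$ imply $y^1=y^2$. *)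

theory Defs
  imports Complex_Main
begin

text \<open>
  A binary relation is a predicate \<open>R\<close>, where \<open>R y1 y2\<close> stands for \<open>y1 \<succ> y2\<close>
  (\<open>y1\<close> is preferred to \<open>y2\<close>); it need not be strict.
\<close>

definition pre_domination :: "('a::real_vector \<Rightarrow> 'a \<Rightarrow> bool) \<Rightarrow> 'a \<Rightarrow> 'a set" where
  "pre_domination R y = {d. R (y - d) y}"

definition Min_elems :: "'a set \<Rightarrow> ('a \<Rightarrow> 'a \<Rightarrow> bool) \<Rightarrow> 'a set" where
  "Min_elems F R = {y0 \<in> F. \<forall>y\<in>F. R y y0 \<longrightarrow> R y0 y}"

text \<open>
  The image below is the Minkowski difference of \<open>y0\<close> and \<open>D\<close>. Minkowski operations are written
  as images throughout, since unary minus on sets denotes the complement.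
\<close>

definition Eff :: "'a::real_vector set \<Rightarrow> 'a set \<Rightarrow> 'a set" where
  "Eff F D = {y0 \<in> F. F \<inter> (\<lambda>d. y0 - d) ` D \<subseteq> {y0}}"

end

theory Submission
  imports Defs
begin

text \<open>
  For \<open>y0, y \<in> F\<close>, both notions of optimality are conditions on the displacement \<open>y0 - y\<close>:
  \<open>y\<close> is preferred to \<open>y0\<close> iff the displacement lies in the pre-domination set at \<open>y0\<close>, and
  \<open>y\<close> violates efficiency of \<open>y0\<close> iff the displacement lies in \<open>D\<close> and \<open>y \<noteq> y0\<close>. The two
  differ in what they tolerate: minimality allows a better \<open>y\<close> when the preference is mutual,
  efficiency only allows \<open>y = y0\<close>. If the pre-domination set is constantly \<open>D\<close>, mutual preference
  means that the displacement and its negative both lie in \<open>D\<close>, so removing \<open>- D\<close> from \<open>D\<close>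
  discards precisely the tolerated displacements. If the relation is asymmetric or antisymmetric,
  mutual preference already forces \<open>y = y0\<close>, and nothing has to be removed. The one-sided
  inclusions \<open>Eff_subset_Min_elems\<close> and \<open>Min_elems_subset_Eff\<close> then combine to the equality
  with \<open>Eff F D\<close>.
\<close>

lemma diff_in_pre_domination_iff: "y0 - y \<in> pre_domination R y0 \<longleftrightarrow> R y y0"
  by (simp add: pre_domination_def)

lemma in_Eff_iff: "y0 \<in> Eff F D \<longleftrightarrow> y0 \<in> F \<and> (\<forall>y\<in>F. y0 - y \<in> D \<longrightarrow> y = y0)"
proof -
  have "y \<in> (\<lambda>d. y0 - d) ` D \<longleftrightarrow> y0 - y \<in> D" for y
    by (force simp: image_iff)
  then show ?thesis
    unfolding Eff_def by blast
qed

lemma in_Min_elems_iff: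
  "y0 \<in> Min_elems F R \<longleftrightarrow> y0 \<in> F \<and> (\<forall>y\<in>F. R y y0 \<longrightarrow> R y0 y)"
  by (simp add: Min_elems_def)

text \<open>
  The displacement back from \<open>y\<close> to \<open>y0\<close> is the negative of the one from \<open>y0\<close> to \<open>y\<close>, and the
  pre-domination set is the same at both points; so a preference is one-sided exactly when its
  displacement lies outside \<open>- D\<close>. The case \<open>y = y0\<close>, which efficiency excuses, cannot arise as
  such a displacement, since \<open>0 = - 0\<close> never survives the removal of \<open>- D\<close>.
\<close>

lemma Min_elems_eq_Eff_asymmetric_part:
  assumes "\<forall>y\<in>F. pre_domination R y = D"
  shows "Min_elems F R = Eff F (D - uminus ` D)"
proof -
  have pref: "R y y' \<longleftrightarrow> y' - y \<in> D" if "y' \<in> F" for y y'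
    using assms that diff_in_pre_domination_iff[of y' y R] by simp
  have neg: "y0 - y \<in> uminus ` D \<longleftrightarrow> y - y0 \<in> D" for y0 y
    by (auto simp: image_iff equation_minus_iff[of "y0 - y"])
  show ?thesis
  proof (intro set_eqI)
    fix y0
    have "(R y y0 \<longrightarrow> R y0 y) \<longleftrightarrow> (y0 - y \<in> D - uminus ` D \<longrightarrow> y = y0)"
      if "y0 \<in> F" "y \<in> F" for y
      using pref[OF that(1), of y] pref[OF that(2), of y0] by (cases "y = y0") (simp_all add: neg)
    then show "y0 \<in> Min_elems F R \<longleftrightarrow> y0 \<in> Eff F (D - uminus ` D)"
      unfolding in_Min_elems_iff in_Eff_iff by blast
  qed
qed

text \<open>
  A point preferred to an efficient \<open>y0\<close> must be \<open>y0\<close> itself, and preference of a point to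
  itself is trivially mutual.
\<close>

lemma Eff_subset_Min_elems:
  assumes "\<forall>y\<in>F. pre_domination R y \<subseteq> D"
  shows "Eff F D \<subseteq> Min_elems F R"
proof
  fix y0
  assume y0: "y0 \<in> Eff F D"
  have "R y0 y" if "y \<in> F" "R y y0" for y
  proof -
    have "y0 - y \<in> D"
      using assms y0 that diff_in_pre_domination_iff[of y0 y R] by (auto simp: in_Eff_iff)
    then have "y = y0"
      using y0 that by (simp add: in_Eff_iff)
    with that show ?thesis
      by simp
  qed
  then show "y0 \<in> Min_elems F R"
    using y0 by (simp add: in_Min_elems_iff in_Eff_iff)
qed

text \<open>
  A displacement in \<open>D\<close> gives a preference over the minimal point, which minimality makes mutual.
  Asymmetry rules this out and antisymmetry identifies the two points.
\<close>

lemma Min_elems_subset_Eff: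
  assumes asym: "asymp R \<or> antisymp R"
    and D: "\<forall>y\<in>F. D \<subseteq> pre_domination R y"
  shows "Min_elems F R \<subseteq> Eff F D"
proof
  fix y0
  assume y0: "y0 \<in> Min_elems F R"
  have "y = y0" if "y \<in> F" "y0 - y \<in> D" for y
  proof -
    have "R y y0"
      using D y0 that diff_in_pre_domination_iff[of y0 y R] by (auto simp: in_Min_elems_iff)
    moreover from this have "R y0 y"
      using y0 that by (simp add: in_Min_elems_iff)
    ultimately show ?thesis
      using asym by (auto dest: asympD antisympD)
  qed
  then show "y0 \<in> Eff F D"
    using y0 by (simp add: in_Min_elems_iff in_Eff_iff)
qed

theorem proposition4:
  fixes R :: "'a::real_vector \<Rightarrow> 'a \<Rightarrow> bool" and F D :: "'a set"
  shows "((\<forall>y\<in>F. pre_domination R y = D) \<longrightarrow>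
            Min_elems F R = Eff F (D - uminus ` D) \<and>
            (asymp R \<or> antisymp R \<longrightarrow> Min_elems F R = Eff F D))
       \<and> ((\<forall>y\<in>F. pre_domination R y \<subseteq> D) \<longrightarrow> Eff F D \<subseteq> Min_elems F R)
       \<and> ((asymp R \<or> antisymp R) \<and> (\<forall>y\<in>F. D \<subseteq> pre_domination R y) \<longrightarrow>
            Min_elems F R \<subseteq> Eff F D)"
proof (intro conjI impI)
  assume const: "\<forall>y\<in>F. pre_domination R y = D"
  then show "Min_elems F R = Eff F (D - uminus ` D)"
    by (rule Min_elems_eq_Eff_asymmetric_part)
  assume "asymp R \<or> antisymp R"
  with const show "Min_elems F R = Eff F D"
    by (intro equalityI Min_elems_subset_Eff Eff_subset_Min_elems) simp_all
next
  assume "\<forall>y\<in>F. pre_domination R y \<subseteq> D"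
  then show "Eff F D \<subseteq> Min_elems F R"
    by (rule Eff_subset_Min_elems)
next
  assume "(asymp R \<or> antisymp R) \<and> (\<forall>y\<in>F. D \<subseteq> pre_domination R y)"
  then show "Min_elems F R \<subseteq> Eff F D"
    by (intro Min_elems_subset_Eff) simp_all
qed

end
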